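(* Every $n$-variable bent function $f:\{-1,1\}^n\to\{-1,1\}$ has a polynomial threshold function representation using at most $0.75\times 2^n$ monomials (i.e. with at most $0.75\times 2^n$ non-zero coefficients) in which all coefficients are integers of absolute value at most $2^n$.
   Context: An $n$-variable Boolean function ($n\ge 1$) is a map $f:\{-1,1\}^n\to\{-1,1\}$. It has a unique expansion $f(x)=\sum_{S\subseteq\{1,\dots,n\}} s_S\prod_{k\in S}x_k$ with real $s_S$; the numbers $2^n s_S$ are its Walsh coefficients. $f$ is called bent if all its Walsh coefficients are $\pm 2^{n/2}$ (bent functions exist only for even $n$). A multilinear polynomial $p(x)=\sum_{S} w_S\prod_{k\in S}x_k$ is a polynomial threshold function (PTF) representation of $f$ if $f(x)=\operatorname{sgn}(p(x))$ for all $x\in\{-1,1\}^n$; in particular $p(x)\neq 0$ for all such $x$. *)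

theory Defs
  imports Complex_Main "HOL-Library.FuncSet"
begin

(* A point of the cube is a function on the index set {1..n}, fixed to be
   undefined elsewhere, so that distinct members of cube n are distinct points. *)
definition cube :: "nat \<Rightarrow> (nat \<Rightarrow> real) set" where
  "cube n = {1..n} \<rightarrow>\<^sub>E {-1, 1}"

(* Values of f outside cube n are irrelevant and left unconstrained. *)
definition boolean_function :: "nat \<Rightarrow> ((nat \<Rightarrow> real) \<Rightarrow> real) \<Rightarrow> bool" where
  "boolean_function n f \<longleftrightarrow> f \<in> cube n \<rightarrow> {-1, 1}"

definition multilinear_poly :: "nat \<Rightarrow> (nat set \<Rightarrow> real) \<Rightarrow> (nat \<Rightarrow> real) \<Rightarrow> real" where
  "multilinear_poly n w x = (\<Sum>S\<in>Pow {1..n}. w S * (\<Prod>k\<in>S. x k))"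

(* Extensionality makes the coefficient family unique as a HOL function;
   see ex1_expansion below for existence and uniqueness. *)
definition is_expansion :: "nat \<Rightarrow> ((nat \<Rightarrow> real) \<Rightarrow> real) \<Rightarrow> (nat set \<Rightarrow> real) \<Rightarrow> bool" where
  "is_expansion n f s \<longleftrightarrow>
     s \<in> extensional (Pow {1..n}) \<and> (\<forall>x\<in>cube n. f x = multilinear_poly n s x)"

definition walsh_coeff :: "nat \<Rightarrow> ((nat \<Rightarrow> real) \<Rightarrow> real) \<Rightarrow> nat set \<Rightarrow> real" where
  "walsh_coeff n f S = 2 ^ n * (THE s. is_expansion n f s) S"

definition bent :: "nat \<Rightarrow> ((nat \<Rightarrow> real) \<Rightarrow> real) \<Rightarrow> bool" where
  "bent n f \<longleftrightarrow> boolean_function n f \<and>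
     (\<forall>S\<in>Pow {1..n}. walsh_coeff n f S \<in> {2 powr (real n / 2), - (2 powr (real n / 2))})"

(* Since sgn 0 = 0, for a Boolean function f this forces the polynomial to be
   nonzero on the cube. *)
definition ptf_representation ::
    "nat \<Rightarrow> ((nat \<Rightarrow> real) \<Rightarrow> real) \<Rightarrow> (nat set \<Rightarrow> real) \<Rightarrow> bool" where
  "ptf_representation n f w \<longleftrightarrow> (\<forall>x\<in>cube n. f x = sgn (multilinear_poly n w x))"

definition monomials :: "nat \<Rightarrow> (nat set \<Rightarrow> real) \<Rightarrow> nat set set" where
  "monomials n w = {S \<in> Pow {1..n}. w S \<noteq> 0}"

lemma finite_cube: "finite (cube n)"
  unfolding cube_def by (intro finite_PiE) auto

lemma prod_character:
  fixes n :: nat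
  assumes "S \<subseteq> {1..n}"
  shows "(\<Prod>k\<in>S. x k) = (\<Prod>k\<in>{1..n}. if k \<in> S then x k else (1::real))"
  using assms by (intro prod.mono_neutral_cong_left) auto

lemma characters_orthogonal:
  assumes S: "S \<subseteq> {1..n}" and T: "T \<subseteq> {1..n}"
  shows "(\<Sum>x\<in>cube n. (\<Prod>k\<in>S. x k) * (\<Prod>k\<in>T. x k)) = (if S = T then 2 ^ n else 0)"
proof -
  let ?h = "\<lambda>k y. (if k \<in> S then y else 1) * (if k \<in> T then y else (1::real))"
  have "(\<Sum>x\<in>cube n. (\<Prod>k\<in>S. x k) * (\<Prod>k\<in>T. x k)) = (\<Sum>x\<in>cube n. \<Prod>k\<in>{1..n}. ?h k (x k))"
    unfolding prod_character[OF S] prod_character[OF T] prod.distrib ..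
  also have "\<dots> = (\<Prod>k\<in>{1..n}. \<Sum>y\<in>{-1,1}. ?h k y)"
    unfolding cube_def by (rule prod_sum_PiE[symmetric]) auto
  also have "\<dots> = (\<Prod>k\<in>{1..n}. if k \<in> S \<longleftrightarrow> k \<in> T then 2 else 0)"
    by (intro prod.cong) auto
  also have "\<dots> = (if S = T then 2 ^ n else 0)"
  proof (cases "S = T")
    case False
    then obtain k where "k \<in> {1..n}" "(k \<in> S) \<noteq> (k \<in> T)" using S T by blast
    then show ?thesis using False by (auto simp: prod_zero_iff)
  qed simp
  finally show ?thesis .
qed

lemma characters_complete:
  assumes x: "x \<in> cube n" and y: "y \<in> cube n"
  shows "(\<Sum>S\<in>Pow {1..n}. (\<Prod>k\<in>S. x k) * (\<Prod>k\<in>S. y k)) = (if x = y then 2 ^ n else 0)"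
proof -
  have v: "x k \<in> {-1, 1}" "y k \<in> {-1, 1}" if "k \<in> {1..n}" for k
    using x y that unfolding cube_def by (meson PiE_mem)+
  have "(\<Sum>S\<in>Pow {1..n}. (\<Prod>k\<in>S. x k) * (\<Prod>k\<in>S. y k)) = (\<Prod>k\<in>{1..n}. x k * y k + 1)"
    by (subst prod_add) (auto simp: prod.distrib)
  also have "\<dots> = (if x = y then 2 ^ n else 0)"
  proof (cases "x = y")
    case True
    have "x k * y k + 1 = 2" if "k \<in> {1..n}" for k
      using v(2)[OF that] True by auto
    then have "(\<Prod>k\<in>{1..n}. x k * y k + 1) = (\<Prod>k\<in>{1..n}. 2)"
      by (rule prod.cong[OF refl])
    then show ?thesis using True by simp
  next
    case False
    then obtain k where k: "k \<in> {1..n}" "x k \<noteq> y k"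
      using x y unfolding cube_def by (meson PiE_ext)
    then have "x k * y k + 1 = 0" using v[OF k(1)] by auto
    then show ?thesis using k False by (auto intro!: prod_zero)
  qed
  finally show ?thesis .
qed

lemma expansion_coeff:
  assumes e: "\<forall>x\<in>cube n. f x = multilinear_poly n s x" and S: "S \<subseteq> {1..n}"
  shows "2 ^ n * s S = (\<Sum>x\<in>cube n. f x * (\<Prod>k\<in>S. x k))"
proof -
  have "(\<Sum>x\<in>cube n. f x * (\<Prod>k\<in>S. x k))
      = (\<Sum>x\<in>cube n. \<Sum>T\<in>Pow {1..n}. s T * ((\<Prod>k\<in>T. x k) * (\<Prod>k\<in>S. x k)))"
    using e by (intro sum.cong) (auto simp: multilinear_poly_def sum_distrib_right mult.assoc)
  also have "\<dots> = (\<Sum>T\<in>Pow {1..n}. s T * (\<Sum>x\<in>cube n. (\<Prod>k\<in>T. x k) * (\<Prod>k\<in>S. x k)))"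
    by (subst sum.swap) (simp add: sum_distrib_left)
  also have "\<dots> = (\<Sum>T\<in>Pow {1..n}. if T = S then s T * 2 ^ n else 0)"
    using S by (intro sum.cong) (auto simp: characters_orthogonal)
  also have "\<dots> = 2 ^ n * s S"
    using S by simp
  finally show ?thesis by simp
qed

lemma ex1_expansion: "\<exists>!s. is_expansion n f s"
proof (rule ex_ex1I)
  let ?s = "restrict (\<lambda>S. (\<Sum>y\<in>cube n. f y * (\<Prod>k\<in>S. y k)) / 2 ^ n) (Pow {1..n})"
  have "multilinear_poly n ?s x = f x" if x: "x \<in> cube n" for x
  proof -
    have "multilinear_poly n ?s x =
       (\<Sum>S\<in>Pow {1..n}. \<Sum>y\<in>cube n. f y / 2 ^ n * ((\<Prod>k\<in>S. y k) * (\<Prod>k\<in>S. x k)))"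
      unfolding multilinear_poly_def
    proof (rule sum.cong[OF refl])
      fix S assume S: "S \<in> Pow {1..n}"
      have "?s S * (\<Prod>k\<in>S. x k)
          = (\<Sum>y\<in>cube n. f y * (\<Prod>k\<in>S. y k)) / 2 ^ n * (\<Prod>k\<in>S. x k)"
        by (simp only: restrict_apply if_P[OF S])
      also have "\<dots> = (\<Sum>y\<in>cube n. f y / 2 ^ n * ((\<Prod>k\<in>S. y k) * (\<Prod>k\<in>S. x k)))"
        unfolding sum_divide_distrib sum_distrib_right by (rule sum.cong) simp_all
      finally show "?s S * (\<Prod>k\<in>S. x k)
          = (\<Sum>y\<in>cube n. f y / 2 ^ n * ((\<Prod>k\<in>S. y k) * (\<Prod>k\<in>S. x k)))" .
    qed
    also have "\<dots> = (\<Sum>y\<in>cube n. f y / 2 ^ n * (\<Sum>S\<in>Pow {1..n}. (\<Prod>k\<in>S. y k) * (\<Prod>k\<in>S. x k)))"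
      by (subst sum.swap) (simp add: sum_distrib_left)
    also have "\<dots> = (\<Sum>y\<in>cube n. if y = x then f y else 0)"
    proof (rule sum.cong[OF refl])
      fix y assume y: "y \<in> cube n"
      show "f y / 2 ^ n * (\<Sum>S\<in>Pow {1..n}. (\<Prod>k\<in>S. y k) * (\<Prod>k\<in>S. x k)) =
          (if y = x then f y else 0)"
        unfolding characters_complete[OF y x] by simp
    qed
    also have "\<dots> = f x" using x finite_cube by simp
    finally show ?thesis .
  qed
  then have "is_expansion n f ?s"
    unfolding is_expansion_def by (intro conjI restrict_extensional ballI) (rule sym)
  then show "\<exists>s. is_expansion n f s" by (intro exI[of _ ?s])
next
  fix s t assume st: "is_expansion n f s" "is_expansion n f t"
  show "s = t"
  proof (rule extensionalityI[of _ "Pow {1..n}"])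
    fix S assume "S \<in> Pow {1..n}"
    then have "2 ^ n * s S = 2 ^ n * t S"
      using expansion_coeff[of n f s S] expansion_coeff[of n f t S] st
      by (auto simp: is_expansion_def)
    then show "s S = t S" by simp
  qed (use st in \<open>auto simp: is_expansion_def\<close>)
qed

lemma walsh_coeff_eq:
  assumes "S \<subseteq> {1..n}"
  shows "walsh_coeff n f S = (\<Sum>x\<in>cube n. f x * (\<Prod>k\<in>S. x k))"
  using theI'[OF ex1_expansion[of n f]] assms
  unfolding walsh_coeff_def is_expansion_def by (intro expansion_coeff) auto

end

theory Submission
  imports Defs
begin

text \<open>Rescale the Walsh coefficients of \<open>f\<close> to signs \<open>a S\<close>, so that the polynomial with
  coefficients \<open>a\<close> equals \<open>c f\<close> with \<open>c = 2 powr (n / 2)\<close>, and pair each \<open>S\<close> avoiding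
  \<open>1\<close> with \<open>insert 1 S\<close>. For a sign \<open>\<sigma>\<close>, call the pair aligned if
  \<open>a (insert 1 S) = \<sigma> * a S\<close>. On the half cube \<open>x 1 = \<sigma>\<close> only the aligned pairs contribute
  to the polynomial, and on the half cube \<open>x 1 = -\<sigma>\<close> only the other pairs do, each of them
  contributing \<open>2 * a S\<close> times the character of \<open>S\<close>. Hence the aligned pairs with the large
  weight \<open>2 ^ n\<close>, plus a single monomial \<open>a S\<close> from every other pair, represent the sign of
  \<open>f\<close> on both halves. Choosing \<open>\<sigma>\<close> so that at most half of the \<open>2 ^ (n - 1)\<close> pairs are
  aligned leaves at most \<open>2 ^ (n - 1) + 2 ^ (n - 2)\<close> monomials.\<close>

declare One_nat_def [simp del]

text \<open>Inserting 1 is a bijection from the index sets avoiding 1 onto those containing it. The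
  bracket depends on \<open>x\<close> only through \<open>x 1\<close>, so it is constant on each
  half cube.\<close>

lemma multilinear_poly_pairs:
  assumes "n \<ge> 1"
  shows "multilinear_poly n w x
    = (\<Sum>S\<in>Pow {2..n}. (w S + w (insert 1 S) * x 1) * (\<Prod>k\<in>S. x k))"
proof -
  have P: "Pow {1..n} = Pow {2..n} \<union> insert 1 ` Pow {2..n}"
  proof -
    have "{1..n} = insert 1 {2..n}" using assms by auto
    then show ?thesis by (simp only: Pow_insert)
  qed
  have inj: "inj_on (insert 1) (Pow {2..n})"
  proof (rule inj_onI)
    fix S T :: "nat set"
    assume "S \<in> Pow {2..n}" "T \<in> Pow {2..n}" "insert 1 S = insert 1 T"
    moreover from this have "1 \<notin> S" "1 \<notin> T" by auto
    ultimately show "S = T" by (simp add: insert_ident)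
  qed
  have "multilinear_poly n w x = (\<Sum>S\<in>Pow {2..n}. w S * (\<Prod>k\<in>S. x k))
      + (\<Sum>S\<in>insert 1 ` Pow {2..n}. w S * (\<Prod>k\<in>S. x k))"
    unfolding multilinear_poly_def P by (intro sum.union_disjoint) auto
  also have "(\<Sum>S\<in>insert 1 ` Pow {2..n}. w S * (\<Prod>k\<in>S. x k))
      = (\<Sum>S\<in>Pow {2..n}. w (insert 1 S) * (\<Prod>k\<in>insert 1 S. x k))"
    by (simp only: sum.reindex[OF inj] o_def)
  also have "\<dots> = (\<Sum>S\<in>Pow {2..n}. w (insert 1 S) * x 1 * (\<Prod>k\<in>S. x k))"
  proof (intro sum.cong refl)
    fix S assume "S \<in> Pow {2..n}"
    then have "finite S" "1 \<notin> S" by (auto intro: finite_subset)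
    then show "w (insert 1 S) * (\<Prod>k\<in>insert 1 S. x k)
        = w (insert 1 S) * x 1 * (\<Prod>k\<in>S. x k)"
      by (simp only: prod.insert mult.assoc not_False_eq_True)
  qed
  finally show ?thesis by (simp add: sum.distrib distrib_right)
qed

text \<open>With \<open>c = 2 powr (real n / 2)\<close>, bentness makes every expansion coefficient
  \<open>c / 2 ^ n\<close> or its negative. Since \<open>c * c = 2 ^ n\<close>, this is
  \<open>1 / c\<close> up to sign, so scaling by \<open>c\<close> leaves a sign.\<close>

lemma bent_sign_coeffs:
  assumes "bent n f"
  shows "\<exists>a. (\<forall>S\<in>Pow {1..n}. a S \<in> {-1, 1})
    \<and> (\<forall>x\<in>cube n. multilinear_poly n a x = 2 powr (real n / 2) * f x)"
proof -
  define c :: real where "c = 2 powr (real n / 2)"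
  obtain s where s: "is_expansion n f s" using ex1_expansion by blast
  have cc: "c > 0" "c * c = 2 ^ n"
    by (simp_all add: c_def powr_add[symmetric] powr_realpow)
  have "c * s S \<in> {-1, 1}" if S: "S \<subseteq> {1..n}" for S
  proof -
    have "walsh_coeff n f S = 2 ^ n * s S"
      using expansion_coeff[of n f s S] walsh_coeff_eq[OF S] s S by (simp add: is_expansion_def)
    moreover have "walsh_coeff n f S \<in> {c, - c}"
      using assms S unfolding bent_def c_def by blast
    ultimately have "c * (c * s S) \<in> {c, - c}"
      unfolding mult.assoc[symmetric] cc(2) by simp
    then have "c * (c * s S) = c * 1 \<or> c * (c * s S) = c * -1" by auto
    then have "c * s S = 1 \<or> c * s S = -1"
      using cc(1) by (simp only: mult_cancel_left) auto
    then show ?thesis by auto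
  qed
  moreover have "multilinear_poly n (\<lambda>S. c * s S) x = c * f x" if "x \<in> cube n" for x
    using s that by (simp add: is_expansion_def multilinear_poly_def sum_distrib_left mult.assoc)
  ultimately show ?thesis
    unfolding c_def[symmetric] by (intro exI[of _ "\<lambda>S. c * s S"]) blast
qed

lemma cube_coord:
  assumes "x \<in> cube n" "k \<in> {1..n}"
  shows "x k \<in> {-1, 1}"
  using assms unfolding cube_def by (rule PiE_mem)

lemma abs_prod_cube:
  assumes "x \<in> cube n" "S \<subseteq> {1..n}"
  shows "\<bar>\<Prod>k\<in>S. x k\<bar> = 1"
proof -
  have "\<bar>x k\<bar> = 1" if "k \<in> S" for k
    using cube_coord[OF assms(1) subsetD[OF assms(2) that]] by auto
  then show ?thesis by (simp add: abs_prod)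
qed

theorem theorem4:
  fixes n :: nat and f :: "(nat \<Rightarrow> real) \<Rightarrow> real"
  assumes "n \<ge> 1" and "bent n f"
  shows "\<exists>w :: nat set \<Rightarrow> real.
           ptf_representation n f w \<and>
           real (card (monomials n w)) \<le> 0.75 * 2 ^ n \<and>
           (\<forall>S\<in>Pow {1..n}. w S \<in> \<int> \<and> \<bar>w S\<bar> \<le> 2 ^ n)"
proof -
  define c :: real where "c = 2 powr (real n / 2)"
  obtain a where a: "\<And>S. S \<subseteq> {1..n} \<Longrightarrow> a S \<in> {-1, 1}"
    and af: "\<And>x. x \<in> cube n \<Longrightarrow> multilinear_poly n a x = c * f x"
    using bent_sign_coeffs[OF assms(2)] unfolding c_def[symmetric] Ball_def Pow_iff by metis
  have c: "c \<ge> 1" by (simp add: c_def ge_one_powr_ge_zero)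
  define P :: "nat set set" where "P = Pow {2..n}"
  have finP: "finite P" by (simp add: P_def)
  have PD: "S \<subseteq> {1..n}" "insert 1 S \<subseteq> {1..n}" "1 \<notin> S" if "S \<in> P" for S
    using that assms(1) by (auto simp: P_def subset_iff)
  have cardP: "2 * card P = 2 ^ n"
    using assms(1) by (cases n) (simp_all add: P_def card_Pow)
  define A where "A \<sigma> = {S \<in> P. a (insert 1 S) = \<sigma> * a S}" for \<sigma>
  \<comment> \<open>No pair is aligned for both signs because \<open>a S\<close> is nonzero, so one
    of the two signs aligns at most half of the pairs.\<close>
  have "A 1 \<union> A (-1) \<subseteq> P" "A 1 \<inter> A (-1) = {}"
  proof -
    have "a S \<noteq> 0" if "S \<in> P" for S using a[OF PD(1)[OF that]] by auto
    then show "A 1 \<inter> A (-1) = {}" by (auto simp: A_def)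
  qed (auto simp: A_def)
  then have "card (A 1) + card (A (-1)) \<le> card P"
    using card_Un_disjoint[of "A 1" "A (-1)"] card_mono[OF finP, of "A 1 \<union> A (-1)"]
      finite_subset[OF _ finP] by simp
  then have "2 * card (A 1) \<le> card P \<or> 2 * card (A (-1)) \<le> card P" by linarith
  then obtain \<sigma> where \<sigma>: "\<sigma> \<in> {-1, 1}" and cardA: "2 * card (A \<sigma>) \<le> card P"
    by blast
  have AP: "A \<sigma> \<subseteq> P" by (auto simp: A_def)
  \<comment> \<open>Each pair is tested through \<open>S - {1}\<close> and
    \<open>insert 1 S\<close>, so both of its members get the same verdict.\<close>
  define w where "w S = (if a (insert 1 S) = \<sigma> * a (S - {1}) then 2 ^ n * a S
    else if 1 \<in> S then 0 else a S)" for S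

  have wf: "f x = sgn (multilinear_poly n w x)" if x: "x \<in> cube n" for x
  proof -
    define \<chi> where "\<chi> S = (\<Prod>k\<in>S. x k)" for S
    define B where "B = (\<Sum>S\<in>P - A \<sigma>. a S * \<chi> S)"
    define D where "D = (\<Sum>S\<in>A \<sigma>. a S * \<chi> S)"
    have split: "multilinear_poly n v x = (\<Sum>S\<in>P - A \<sigma>. (v S + v (insert 1 S) * x 1) * \<chi> S)
       + (\<Sum>S\<in>A \<sigma>. (v S + v (insert 1 S) * x 1) * \<chi> S)" for v
      unfolding multilinear_poly_pairs[OF assms(1)] P_def[symmetric] \<chi>_def
      by (rule sum.subset_diff[OF AP finP])
    \<comment> \<open>Both coefficients are signs, so failing to be aligned with \<sigma> means
      being aligned with its negative.\<close>
    have off: "a (insert 1 S) = - \<sigma> * a S" if "S \<in> P - A \<sigma>" for S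
      using that a[OF PD(1), of S] a[OF PD(2), of S] \<sigma> by (auto simp: A_def)
    have pa: "multilinear_poly n a x = (1 - \<sigma> * x 1) * B + (1 + \<sigma> * x 1) * D"
      unfolding split B_def D_def sum_distrib_left
      by (intro arg_cong2[where f = "(+)"] sum.cong refl)
        (simp add: off algebra_simps, simp add: A_def algebra_simps)
    have pw: "multilinear_poly n w x = B + 2 ^ n * ((1 + \<sigma> * x 1) * D)"
      unfolding split B_def D_def sum_distrib_left
    proof (intro arg_cong2[where f = "(+)"] sum.cong refl)
      fix S assume S: "S \<in> P - A \<sigma>"
      then have "w S = a S" "w (insert 1 S) = 0"
        using PD(3)[of S] by (auto simp: w_def A_def)
      then show "(w S + w (insert 1 S) * x 1) * \<chi> S = a S * \<chi> S" by simp
    next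
      fix S assume S: "S \<in> A \<sigma>"
      then have "w S = 2 ^ n * a S" "w (insert 1 S) = 2 ^ n * (\<sigma> * a S)"
        using PD(3)[of S] by (auto simp: w_def A_def)
      then show "(w S + w (insert 1 S) * x 1) * \<chi> S = 2 ^ n * ((1 + \<sigma> * x 1) * (a S * \<chi> S))"
        by (simp add: algebra_simps)
    qed
    have "x 1 \<in> {-1, 1}"
      using cube_coord[OF x, of 1] assms(1) by auto
    then consider "\<sigma> * x 1 = 1" | "\<sigma> * x 1 = -1" using \<sigma> by force
    moreover have f1: "f x \<in> {-1, 1}"
      using assms(2) x by (auto simp: bent_def boolean_function_def)
    ultimately show ?thesis
    proof cases
      \<comment> \<open>By \<open>pa\<close>, the factor of \<open>B\<close> vanishes and
        \<open>2 * D = c * f x\<close>. The term \<open>2 ^ n * c * f x\<close> then outweighs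
        \<open>B\<close>, a sum of at most \<open>card P\<close> signs, where \<open>card P\<close>
        is half of \<open>2 ^ n\<close>.\<close>
      case 1
      have "\<bar>B\<bar> \<le> (\<Sum>S\<in>P - A \<sigma>. \<bar>a S * \<chi> S\<bar>)"
        unfolding B_def by (rule sum_abs)
      also have "\<dots> = (\<Sum>S\<in>P - A \<sigma>. 1)"
      proof (intro sum.cong refl)
        fix S assume "S \<in> P - A \<sigma>"
        then have "S \<subseteq> {1..n}" using PD(1) by blast
        then show "\<bar>a S * \<chi> S\<bar> = 1"
          using a[of S] abs_prod_cube[OF x, of S] by (auto simp: \<chi>_def abs_mult)
      qed
      also have "\<dots> \<le> real (card P)"
        using finP by (simp add: card_mono)
      also have "\<dots> < 2 ^ n"
        using arg_cong[OF cardP, of real] zero_less_power[of "2::real" n]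
        unfolding of_nat_mult of_nat_power of_nat_numeral by linarith
      also have "\<dots> \<le> 2 ^ n * c" using c by simp
      finally have B: "\<bar>B\<bar> < 2 ^ n * c" .
      have "multilinear_poly n w x = B + 2 ^ n * c * f x"
        using pa pw af[OF x] 1 by simp
      then show ?thesis using f1 B by (auto simp: sgn_if abs_less_iff)
    next
      \<comment> \<open>Now the factor of \<open>D\<close> vanishes, so \<open>pa\<close> gives
        \<open>2 * B = c * f x\<close>, and by \<open>pw\<close> only \<open>B\<close>
        remains.\<close>
      case 2
      then have "multilinear_poly n w x = c * f x / 2"
        using pa pw af[OF x] by simp
      then show ?thesis using f1 c by (auto simp: sgn_if)
    qed
  qed

  \<comment> \<open>An index set containing 1 has nonzero weight only if its pair is
    aligned.\<close>
  have "monomials n w \<subseteq> P \<union> insert 1 ` A \<sigma>"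
  proof
    fix S assume S: "S \<in> monomials n w"
    then have S1: "S \<subseteq> {1..n}" and S2: "w S \<noteq> 0" by (auto simp: monomials_def)
    have sub: "S - {1} \<in> P"
    proof -
      have "{1..n} - {1} \<subseteq> {2..n}" by auto
      then show ?thesis using S1 unfolding P_def by blast
    qed
    show "S \<in> P \<union> insert 1 ` A \<sigma>"
    proof (cases "1 \<in> S")
      case True
      then have "S - {1} \<in> A \<sigma>"
        using S2 sub by (auto simp: w_def A_def insert_absorb split: if_splits)
      then show ?thesis using True by (metis UnI2 image_eqI insert_Diff)
    qed (use sub in simp)
  qed
  moreover have "finite (P \<union> insert 1 ` A \<sigma>)"
    using finP finite_subset[OF AP finP] by simp
  ultimately have "card (monomials n w) \<le> card (P \<union> insert 1 ` A \<sigma>)"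
    by (intro card_mono)
  also have "\<dots> \<le> card P + card (A \<sigma>)"
    by (intro order.trans[OF card_Un_le] add_left_mono card_image_le finite_subset[OF AP finP])
  \<comment> \<open>Four times \<open>card P + card (A \<sigma>)\<close> is at most
    \<open>6 * card P\<close>, which is \<open>3 * 2 ^ n\<close>.\<close>
  finally have "4 * card (monomials n w) \<le> 3 * 2 ^ n" using cardA cardP by linarith
  then have "real (4 * card (monomials n w)) \<le> real (3 * 2 ^ n)" by (rule of_nat_mono)
  moreover have "w S \<in> \<int> \<and> \<bar>w S\<bar> \<le> 2 ^ n" if "S \<subseteq> {1..n}" for S
    using a[OF that] by (auto simp: w_def)
  ultimately show ?thesis
    using wf by (intro exI[of _ w]) (auto simp: ptf_representation_def)
qed

end
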